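(* For every $K_3N$ $n=pqr$: (a) $C\le\mathcal C\left(\mathcal N^{-1}(n)\right)$; (b) $ABC\le\mathcal A\left(\mathcal N^{-1}(n)\right)\,\mathcal B\left(\mathcal N^{-1}(n)\right)\,\mathcal C\left(\mathcal N^{-1}(n)\right)$; with equality (in each case) if and only if $E=2$ and $F=G=1$; if there is equality then $H\not\equiv 2\pmod 6$, and if also $n$ is a $C_3N$, then $H\equiv 0\pmod 6$. For large $n$ (i.e. as $n\to\infty$ through $K_3N$'s, with $o(1)$ depending only on $n$), $C\le 2^{-3/5}n^{2/5}(1+o(1))$ and $ABC\le 2^{-3/10}n^{7/10}(1+o(1))$.
   Context: A $K_3N$ (Korselt number with three factors) is an integer $n$ together with a factorisation $n=pqr$, where $1<p<q<r$ are odd integers (not necessarily prime) such that each of $p-1,\ q-1,\ r-1$ divides $n-1$, and such that $E:=\dfrac{pq-1}{r-1}$ (which is an integer by the divisibility condition) satisfies $E\ge 2$. A $C_3N$ is a Carmichael number with exactly three prime factors $p<q<r$, i.e. a $K_3N$ $n=pqr$ in which $p,q,r$ are all prime. Put $H:=\gcd(p-1,q-1,r-1)$, $A:=\frac{p-1}{H}$, $B:=\frac{q-1}{H}$, $C:=\frac{r-1}{H}$, $F:=H\left(\frac1A+\frac1B+\frac1C\right)+\frac1{AB}+\frac1{AC}+\frac1{BC}$ (which is a positive integer), and $G:=AF-H$. The following polynomials are used: $\mathcal A(x):=x+1$, $\mathcal B(x):=x^2+x+3$, $\mathcal C(x):=\frac12\left(x^4+2x^3+5x^2+5x+4\right)$,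 and $$\mathcal N(x):=\tfrac12\left(x^{10}+4x^9+14x^8+30x^7+53x^6+69x^5+71x^4+55x^3+31x^2+12x+2\right).$$ $\mathcal N$ is a strictly increasing bijection from $[0,\infty)$ onto $[1,\infty)$ and $\mathcal N^{-1}$ denotes its inverse. *)

theory Defs
  imports Complex_Main "HOL-Number_Theory.Cong" "HOL-Computational_Algebra.Primes"
    "HOL-Library.Landau_Symbols"
begin

text \<open>In this quotient and the ones below, all natural-number subtractions are non-truncating
  when \<open>p, q, r \<ge> 1\<close>. \<open>E_quot\<close> is a quotient of reals: for a \<open>K\<^sub>3N\<close> it is an integer,
  because \<open>r - 1\<close> divides \<open>pqr - 1 = pq (r - 1) + (pq - 1)\<close>.\<close>

definition E_quot :: "nat \<Rightarrow> nat \<Rightarrow> nat \<Rightarrow> real" where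
  "E_quot p q r = real (p * q - 1) / real (r - 1)"

definition K3N :: "nat \<Rightarrow> nat \<Rightarrow> nat \<Rightarrow> nat \<Rightarrow> bool" where
  "K3N n p q r \<longleftrightarrow>
     n = p * q * r \<and> 1 < p \<and> p < q \<and> q < r \<and> odd p \<and> odd q \<and> odd r \<and>
     (p - 1) dvd (n - 1) \<and> (q - 1) dvd (n - 1) \<and> (r - 1) dvd (n - 1) \<and>
     E_quot p q r \<ge> 2"

text \<open>By Korselt's criterion these are the Carmichael numbers with exactly three prime factors;
  the factorisation is then unique, so being a \<open>C\<^sub>3N\<close> is a property of \<open>n\<close> alone.\<close>

definition C3N :: "nat \<Rightarrow> nat \<Rightarrow> nat \<Rightarrow> nat \<Rightarrow> bool" where
  "C3N n p q r \<longleftrightarrow> K3N n p q r \<and> prime p \<and> prime q \<and> prime r"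

definition H_gcd :: "nat \<Rightarrow> nat \<Rightarrow> nat \<Rightarrow> nat" where
  "H_gcd p q r = gcd (p - 1) (gcd (q - 1) (r - 1))"

text \<open>The divisions by \<open>H_gcd p q r\<close> are exact.\<close>

definition A_cof :: "nat \<Rightarrow> nat \<Rightarrow> nat \<Rightarrow> nat" where
  "A_cof p q r = (p - 1) div H_gcd p q r"

definition B_cof :: "nat \<Rightarrow> nat \<Rightarrow> nat \<Rightarrow> nat" where
  "B_cof p q r = (q - 1) div H_gcd p q r"

definition C_cof :: "nat \<Rightarrow> nat \<Rightarrow> nat \<Rightarrow> nat" where
  "C_cof p q r = (r - 1) div H_gcd p q r"

definition F_val :: "nat \<Rightarrow> nat \<Rightarrow> nat \<Rightarrow> real" where
  "F_val p q r =
     (let H = real (H_gcd p q r);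
          A = real (A_cof p q r); B = real (B_cof p q r); C = real (C_cof p q r)
      in H * (1 / A + 1 / B + 1 / C) + 1 / (A * B) + 1 / (A * C) + 1 / (B * C))"

definition G_val :: "nat \<Rightarrow> nat \<Rightarrow> nat \<Rightarrow> real" where
  "G_val p q r = real (A_cof p q r) * F_val p q r - real (H_gcd p q r)"

definition poly_A :: "real \<Rightarrow> real" where
  "poly_A x = x + 1"

definition poly_B :: "real \<Rightarrow> real" where
  "poly_B x = x ^ 2 + x + 3"

definition poly_C :: "real \<Rightarrow> real" where
  "poly_C x = 1 / 2 * (x ^ 4 + 2 * x ^ 3 + 5 * x ^ 2 + 5 * x + 4)"

definition poly_N :: "real \<Rightarrow> real" where
  "poly_N x = 1 / 2 * (x ^ 10 + 4 * x ^ 9 + 14 * x ^ 8 + 30 * x ^ 7 + 53 * x ^ 6 + 69 * x ^ 5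
     + 71 * x ^ 4 + 55 * x ^ 3 + 31 * x ^ 2 + 12 * x + 2)"

text \<open>\<open>poly_N\<close> is a strictly increasing bijection from \<open>[0, \<infinity>)\<close> onto \<open>[1, \<infinity>)\<close>, so on
  \<open>[1, \<infinity>)\<close> the following is its inverse; values at arguments below 1 are irrelevant.\<close>

definition N_inv :: "real \<Rightarrow> real" where
  "N_inv = inv_into {0..} poly_N"

end

theory Submission
  imports Defs "HOL-Real_Asymp.Real_Asymp"
begin

text \<open>
  With \<open>p = HA + 1\<close>, \<open>q = HB + 1\<close>, \<open>r = HC + 1\<close> the divisibility conditions become
  \<open>EC = HAB + A + B\<close>, \<open>AF = G + H\<close> and \<open>BG = HA + E + 1\<close> in positive integers. Eliminating
  \<open>A\<close> and \<open>B\<close> bounds \<open>C\<close> and \<open>ABC\<close> by functions of \<open>E\<close>, \<open>G\<close>, \<open>H\<close> of the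
  shape \<open>a/t + bt + c\<close> in \<open>t = G\<close> and then in \<open>t = E\<close>, which on the admissible ranges are largest
  at the left end points \<open>G = 1\<close> and \<open>E = 2\<close>; there they take the values \<open>\<C>(H)\<close> and
  \<open>\<A>(H)\<B>(H)\<C>(H)\<close>. Finally \<open>n = (EHC + 1)(HC + 1) = HABC(H\<^sup>2 + F) + 1\<close>, while \<open>\<N>(x)\<close>
  is given by the same expressions with \<open>E = 2\<close>, \<open>F = 1\<close>, \<open>H = x\<close>. Hence if \<open>C\<close> or \<open>ABC\<close>
  were at least its bound at \<open>x = \<N>\<^sup>-\<^sup>1(n)\<close>, then \<open>x \<le> H\<close>, and \<open>n = \<N>(x)\<close> forces equality throughout.
\<close>

section \<open>The polynomials\<close>

text \<open>At \<open>x = H\<close> this has the shape of \<open>n_via_C\<close> for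
  \<open>E = 2\<close>, and \<open>poly_N_via_ABC\<close> that of \<open>n_via_ABC\<close> for
  \<open>F = 1\<close>.\<close>

lemma poly_N_via_C: "poly_N x = (2 * x * poly_C x + 1) * (x * poly_C x + 1)"
  unfolding poly_N_def poly_C_def by (simp add: field_simps) algebra

lemma poly_N_via_ABC: "poly_N x = x * (poly_A x * poly_B x * poly_C x) * (x\<^sup>2 + 1) + 1"
  unfolding poly_N_def poly_A_def poly_B_def poly_C_def by (simp add: field_simps) algebra

lemma poly_C_strict_mono: "poly_C x < poly_C y" if "0 \<le> x" "x < y"
proof -
  have "x ^ 2 < y ^ 2" "x ^ 3 < y ^ 3" "x ^ 4 < y ^ 4"
    using that by (auto intro!: power_strict_mono)
  with that show ?thesis
    unfolding poly_C_def by simp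
qed

lemma poly_pos:
  assumes "0 \<le> x"
  shows "poly_A x > 0" "poly_B x > 0" "poly_C x > 0"
  using assms by (auto simp: poly_A_def poly_B_def poly_C_def intro!: add_nonneg_pos)

lemma poly_ABC_strict_mono:
  assumes "0 \<le> x" "x < y"
  shows "poly_A x * poly_B x * poly_C x < poly_A y * poly_B y * poly_C y"
proof -
  have "poly_A x < poly_A y" "poly_B x < poly_B y"
    using assms power_strict_mono[of x y 2] by (auto simp: poly_A_def poly_B_def)
  with poly_C_strict_mono[OF assms] poly_pos[of x] poly_pos[of y] assms show ?thesis
    by (intro mult_strict_mono) auto
qed

lemma poly_N_strict_mono: "poly_N x < poly_N y" if "0 \<le> x" "x < y"
proof -
  have "x * poly_C x < y * poly_C y"
    using that poly_C_strict_mono[OF that] poly_pos(3)[of x] by (intro mult_strict_mono) auto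
  moreover have "0 \<le> x * poly_C x"
    using that poly_pos(3)[of x] by simp
  ultimately show ?thesis
    unfolding poly_N_via_C by (intro mult_strict_mono) auto
qed

lemma inj_on_poly_N: "inj_on poly_N {0..}"
  by (rule linorder_inj_onI) (use poly_N_strict_mono in \<open>force+\<close>)

lemma N_inv_poly_N: "0 \<le> x \<Longrightarrow> N_inv (poly_N x) = x"
  unfolding N_inv_def using inj_on_poly_N by (simp add: inv_into_f_f)

lemma
  assumes "1 \<le> y"
  shows N_inv_nonneg: "0 \<le> N_inv y" and poly_N_N_inv: "poly_N (N_inv y) = y"
proof -
  have "\<exists>x\<ge>0. x \<le> y \<and> poly_N x = y"
  proof (rule IVT')
    show "poly_N 0 \<le> y"
      using assms by (simp add: poly_N_def)
    have "0 \<le> y" "0 \<le> y ^ k" for k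
      using assms by auto
    \<comment> \<open>All coefficients are nonnegative and the linear one is 6, so \<open>y\<close>
      itself can serve as the right end point for the intermediate value theorem.\<close>
    then have "1 / 2 * (0 + 2 * y) \<le> poly_N y"
      unfolding poly_N_def by (intro mult_left_mono) (auto intro!: add_mono add_increasing2 add_increasing)
    then show "y \<le> poly_N y"
      by simp
    show "continuous_on {0..y} poly_N"
      unfolding poly_N_def by (intro continuous_intros)
  qed (use assms in simp)
  then have "y \<in> poly_N ` {0..}"
    by force
  then show "0 \<le> N_inv y" "poly_N (N_inv y) = y"
    unfolding N_inv_def using inv_into_into[of y poly_N "{0..}"] by (auto simp: f_inv_into_f)
qed

section \<open>The integers attached to a three-factor Korselt number\<close>

text \<open>\<open>EC\<close> is pq - 1 = E(r - 1) divided by \<open>H\<close>. \<open>BG\<close>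
  results from multiplying the definition of F by \<open>A * B * C\<close>, substituting
  \<open>AF\<close> and \<open>EC\<close>, and cancelling \<open>C\<close>.\<close>

locale korselt3 =
  fixes A B C E F G H :: nat
  assumes A_pos: "0 < A" and A_less_B: "A < B" and B_less_C: "B < C" and H_pos: "0 < H"
    and E_ge_2: "2 \<le> E" and F_pos: "0 < F" and G_pos: "0 < G"
    and EC: "E * C = H * A * B + A + B"
    and AF: "A * F = G + H"
    and BG: "B * G = H * A + E + 1"
begin

section \<open>Size constraints on E, G and A\<close>

lemma E_le: "E \<le> H * A"
proof (rule ccontr)
  assume "\<not> E \<le> H * A"
  \<comment> \<open>Since \<open>C\<close> is at least \<open>B + 1\<close>, a larger
    \<open>E\<close> would make \<open>E * C\<close> exceed the right-hand side of
    \<open>EC\<close>.\<close>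
  then have "(H * A + 1) * (B + 1) \<le> E * C"
    using B_less_C by (intro mult_le_mono) auto
  then have "H * A * B + H * A + B + 1 \<le> H * A * B + A + B"
    unfolding EC by (simp add: algebra_simps)
  moreover have "A \<le> H * A"
    using H_pos by simp
  ultimately show False
    by linarith
qed

lemma G_le: "G \<le> 2 * H"
proof (rule ccontr)
  assume "\<not> G \<le> 2 * H"
  then have "(A + 1) * (2 * H + 1) \<le> B * G"
    using A_less_B by (intro mult_le_mono) auto
  then show False
    unfolding BG using E_le A_pos by (simp add: algebra_simps)
qed

lemma A_le: "A \<le> G + H"
  using AF F_pos by (metis dvd_imp_le dvd_triv_left add_pos_pos G_pos H_pos)

text \<open>Keeps \<open>E\<close> below the second root of the quadratic behind
  \<open>ABC_le\<close>, that is, makes \<open>z\<close> positive there.\<close>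

lemma two_E_less: "2 * E < H ^ 4 + 2 * H ^ 3 + 3 * H\<^sup>2 + 3 * H + 2"
proof -
  have "E \<le> H * (3 * H)"
    by (rule le_trans[OF E_le]) (use A_le G_le in simp)
  moreover have "H\<^sup>2 \<le> H ^ 4" "H\<^sup>2 \<le> H ^ 3"
    using H_pos by (auto intro!: power_increasing)
  ultimately show ?thesis
    by (simp add: power2_eq_square)
qed

text \<open>Keeps \<open>G\<close> below the second root of the quadratics in \<open>EC_le\<close>
  and \<open>AB_le\<close>, whose first root is 1.\<close>

lemma G_less: "G < H\<^sup>2 + E + 1"
proof -
  have "2 * H \<le> H\<^sup>2 + 1"
    using sum_squares_bound[of "real H" 1] by (simp flip: of_nat_power of_nat_add of_nat_mult of_nat_le_iff)
  then show ?thesis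
    using G_le E_ge_2 by simp
qed

section \<open>Bounds for C and ABC by polynomials in H\<close>

definition c_bound :: real where
  "c_bound = real H ^ 4 + 2 * real H ^ 3 + (real E + 3) * real H ^ 2 + (real E + 3) * H + E + 2"

text \<open>Multiplying by \<open>G\<close> eliminates \<open>B\<close>, and the result increases
  with \<open>A\<close>, which is at most \<open>G + H\<close>. Putting \<open>A = G + H\<close>
  leaves a convex quadratic in \<open>G\<close> that meets \<open>G * c_bound\<close> at
  \<open>G = 1\<close> and \<open>G = H^2 + E + 1\<close> and lies below it in between;
  \<open>c_bound\<close> is its value at \<open>G = 1\<close>.\<close>

lemma EC_le:
  "real E * C \<le> c_bound"
  "real E * C = c_bound \<Longrightarrow> F = 1 \<and> G = 1"
proof -
  define a b c e g h where abbrs: "a = real A" "b = real B" "c = real C" "e = real E" "g = real G" "h = real H"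
  have pos: "0 < a" "1 \<le> g" "0 < h" "0 < e"
    using A_pos G_pos H_pos E_ge_2 unfolding abbrs by auto
  have bg: "b * g = h * a + e + 1" and ec: "e * c = h * a * b + a + b"
    unfolding abbrs using BG EC by (metis of_nat_1 of_nat_add of_nat_mult)+
  have ale: "a \<le> g + h" and gless: "g < h\<^sup>2 + e + 1"
    unfolding abbrs using A_le G_less by (metis of_nat_1 of_nat_add of_nat_mult of_nat_power of_nat_le_iff of_nat_less_iff)+
  have 1: "g * (e * c) = (h * a + e + 1) * (h * a + 1) + g * a"
    using bg ec by algebra
  have 2: "(h * a + e + 1) * (h * a + 1) + g * a
      \<le> (h * (g + h) + e + 1) * (h * (g + h) + 1) + g * a"
    using ale pos by (intro add_mono mult_mono) auto
  have 3: "(h * (g + h) + e + 1) * (h * (g + h) + 1) + g * (g + h)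
      = g * c_bound - (g - 1) * (h\<^sup>2 + 1) * (h\<^sup>2 + e + 1 - g)"
    unfolding c_bound_def abbrs[symmetric] by algebra
  have 4: "0 \<le> (g - 1) * (h\<^sup>2 + 1) * (h\<^sup>2 + e + 1 - g)"
    using gless pos by (intro mult_nonneg_nonneg) auto
  have 5: "g * a \<le> g * (g + h)"
    using ale pos by simp
  have "g * (e * c) \<le> g * c_bound"
    using 1 2 3 4 5 by linarith
  then show "real E * C \<le> c_bound"
    using pos unfolding abbrs by simp
  assume "real E * C = c_bound"
  then have "g * (e * c) = g * c_bound"
    unfolding abbrs by simp
  \<comment> \<open>Equality makes both losses vanish: that of the quadratic, and that of replacing
    \<open>a\<close> by \<open>g + h\<close>. The latter yields \<open>A = G + H\<close>, hence
    \<open>F = 1\<close> by \<open>AF\<close>.\<close>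
  then have "(g - 1) * (h\<^sup>2 + 1) * (h\<^sup>2 + e + 1 - g) = 0" "g * a = g * (g + h)"
    using 1 2 3 4 5 by linarith+
  moreover have "h\<^sup>2 + 1 \<noteq> 0"
    by (smt (verit) zero_le_power2)
  ultimately have "g = 1" "a = g + h"
    using gless pos by auto
  then have "G = 1" "A = G + H"
    unfolding abbrs by linarith+
  then show "F = 1 \<and> G = 1"
    using AF A_pos by (metis mult_cancel1 nat_mult_1_right not_gr0)
qed

text \<open>The elimination of \<open>EC_le\<close> again; the loss is now
  \<open>h * (g - 1) * (h^2 + e + 1 - g)\<close>, with the same two roots in
  \<open>g\<close>.\<close>

lemma AB_le: "real A * B \<le> (real H + 1) * (real H ^ 2 + H + E + 1)"
proof -
  define a b e g h where abbrs: "a = real A" "b = real B" "e = real E" "g = real G" "h = real H"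
  have pos: "0 < a" "1 \<le> g" "0 < h" "0 < e"
    using A_pos G_pos H_pos E_ge_2 unfolding abbrs by auto
  have bg: "b * g = h * a + e + 1"
    unfolding abbrs using BG by (metis of_nat_1 of_nat_add of_nat_mult)
  have ale: "a \<le> g + h" and gless: "g < h\<^sup>2 + e + 1"
    unfolding abbrs using A_le G_less by (metis of_nat_1 of_nat_add of_nat_mult of_nat_power of_nat_le_iff of_nat_less_iff)+
  have "g * (a * b) = a * (h * a + e + 1)"
    using bg by algebra
  also have "\<dots> \<le> (g + h) * (h * (g + h) + e + 1)"
    using ale pos by (intro mult_mono add_mono) auto
  also have "\<dots> = g * ((h + 1) * (h\<^sup>2 + h + e + 1)) - h * (g - 1) * (h\<^sup>2 + e + 1 - g)"
    by algebra
  also have "\<dots> \<le> g * ((h + 1) * (h\<^sup>2 + h + e + 1))"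
    using gless pos by simp
  finally show ?thesis
    using pos unfolding abbrs[symmetric] by simp
qed

text \<open>\<open>c_bound\<close> is linear in \<open>E\<close> and equals
  \<open>2 * poly_C H\<close> at \<open>E = 2\<close>, so its shortfall from
  \<open>E * poly_C H\<close> is a multiple of \<open>E - 2\<close>.\<close>

lemma c_bound_eq:
  "c_bound = E * poly_C H - (real E - 2) / 2 * (H ^ 4 + 2 * H ^ 3 + 3 * H\<^sup>2 + 3 * H + 2)"
  unfolding c_bound_def poly_C_def by (simp add: field_simps)

lemma C_le:
  "real C \<le> poly_C H"
  "real C = poly_C H \<Longrightarrow> F = 1 \<and> G = 1"
proof -
  have *: "c_bound \<le> E * poly_C H"
    unfolding c_bound_eq using E_ge_2 by simp
  then have "real E * C \<le> E * poly_C H"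
    using EC_le(1) by linarith
  then show "real C \<le> poly_C H"
    using E_ge_2 by simp
  assume "real C = poly_C H"
  then have "real E * C = c_bound"
    using * EC_le(1) by simp
  then show "F = 1 \<and> G = 1"
    by (rule EC_le(2))
qed

lemma ABC_le:
  "real (A * B * C) \<le> poly_A H * poly_B H * poly_C H"
  "real (A * B * C) = poly_A H * poly_B H * poly_C H \<Longrightarrow> E = 2 \<and> F = 1 \<and> G = 1"
proof -
  define P where "P = poly_A H * poly_B H * poly_C H"
  define d where "d = (real H + 1) * (real H ^ 2 + H + E + 1)"
  define w where "w = (real H + 1) * (H\<^sup>2 + H + 1)"
  define z where "z = real (H ^ 4 + 2 * H ^ 3 + 3 * H\<^sup>2 + 3 * H + 2) / 2 - E"
  have "0 < w" "0 < d"
    unfolding w_def d_def by (auto intro!: mult_pos_pos add_nonneg_pos simp: H_pos E_ge_2)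
  have "0 < z"
    unfolding z_def using of_nat_less_iff[where 'a = real, THEN iffD2, OF two_E_less] by simp
  \<comment> \<open>\<open>d * c_bound - E * P\<close> is a quadratic in \<open>E\<close> with
    leading coefficient \<open>w\<close>; one root is 2, and the other exceeds \<open>E\<close> by
    \<open>z\<close>.\<close>
  have eq: "E * P = d * c_bound + w * (real E - 2) * z"
    unfolding P_def d_def w_def z_def c_bound_def poly_A_def poly_B_def poly_C_def
    by (simp add: field_simps)
  have nonneg: "0 \<le> w * (real E - 2) * z"
    using \<open>0 < w\<close> \<open>0 < z\<close> E_ge_2 by simp
  have "E * real (A * B * C) = (real A * B) * (real E * C)"
    by simp
  moreover have "\<dots> \<le> d * (real E * C)"
    using AB_le unfolding d_def by (intro mult_right_mono) auto
  moreover have "d * (real E * C) \<le> d * c_bound"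
    using EC_le(1) \<open>0 < d\<close> by simp
  ultimately have chain: "E * real (A * B * C) \<le> d * (real E * C)" "d * (real E * C) \<le> d * c_bound"
    by linarith+
  then have "E * real (A * B * C) \<le> E * P"
    using eq nonneg by linarith
  then show "real (A * B * C) \<le> poly_A H * poly_B H * poly_C H"
    using E_ge_2 unfolding P_def by simp
  assume "real (A * B * C) = poly_A H * poly_B H * poly_C H"
  then have "E * real (A * B * C) = E * P"
    unfolding P_def by simp
  then have "w * (real E - 2) * z = 0" "d * (real E * C) = d * c_bound"
    using chain eq nonneg by linarith+
  then show "E = 2 \<and> F = 1 \<and> G = 1"
    using \<open>0 < w\<close> \<open>0 < z\<close> \<open>0 < d\<close> EC_le(2) by simp
qed

section \<open>Two expressions for n\<close>

definition n :: nat where "n = (H * A + 1) * (H * B + 1) * (H * C + 1)"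

text \<open>By \<open>EC\<close>, pq = \<open>E * H * C + 1\<close>.\<close>

lemma n_via_C: "n = (E * H * C + 1) * (H * C + 1)"
proof -
  have "(H * A + 1) * (H * B + 1) = H * (H * A * B + A + B) + 1"
    by (simp add: algebra_simps)
  then show ?thesis
    unfolding n_def EC[symmetric] by (simp add: algebra_simps)
qed

text \<open>Apart from the terms H^3 ABC and 1, the expanded product is \<open>H\<close> times a sum
  that the three equations identify as \<open>A * B * C * F\<close>.\<close>

lemma n_via_ABC: "n = H * (A * B * C) * (H\<^sup>2 + F) + 1"
proof -
  have "A * B * C * F = B * C * (A * F)"
    by simp
  also have "\<dots> = B * G * C + H * B * C"
    unfolding AF by (simp add: algebra_simps)
  also have "\<dots> = H * (A * B + A * C + B * C) + A + B + C"
    unfolding BG using EC by (simp add: algebra_simps)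
  finally have ABCF: "A * B * C * F = H * (A * B + A * C + B * C) + A + B + C" .
  have "n = H * (H\<^sup>2 * (A * B * C) + (H * (A * B + A * C + B * C) + A + B + C)) + 1"
    unfolding n_def by (simp add: algebra_simps power2_eq_square)
  then show ?thesis
    unfolding ABCF[symmetric] by (simp add: algebra_simps)
qed

lemma n_ge_1: "1 \<le> real n"
  unfolding n_via_ABC by simp

section \<open>Comparison of n with \<open>poly_N\<close> at its preimage\<close>

abbreviation "x \<equiv> N_inv (real n)"

lemma x_nonneg: "0 \<le> x" and poly_N_x: "poly_N x = n"
  using N_inv_nonneg poly_N_N_inv n_ge_1 by auto

lemma extremal_values:
  assumes "E = 2" "F = 1" "G = 1"
  shows "A = H + 1" "B = H\<^sup>2 + H + 3" "2 * C = H ^ 4 + 2 * H ^ 3 + 5 * H\<^sup>2 + 5 * H + 4" "x = H"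
    and "real C = poly_C x" "real (A * B * C) = poly_A x * poly_B x * poly_C x"
proof -
  show A: "A = H + 1"
    using AF assms by simp
  then show B: "B = H\<^sup>2 + H + 3"
    using BG assms by (simp add: power2_eq_square algebra_simps)
  show C: "2 * C = H ^ 4 + 2 * H ^ 3 + 5 * H\<^sup>2 + 5 * H + 4"
    using EC unfolding A B assms by (simp add: algebra_simps power2_eq_square eval_nat_numeral)
  then have "2 * real C = H ^ 4 + 2 * H ^ 3 + 5 * H\<^sup>2 + 5 * H + 4"
    by (metis of_nat_add of_nat_mult of_nat_numeral of_nat_power)
  then have C': "real C = poly_C H"
    unfolding poly_C_def by simp
  have "real n = poly_N H"
    unfolding n_via_C poly_N_via_C C'[symmetric] assms by (simp add: algebra_simps)
  then show x: "x = H"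
    by (simp add: N_inv_poly_N)
  show "real C = poly_C x"
    unfolding x by (rule C')
  show "real (A * B * C) = poly_A x * poly_B x * poly_C x"
    unfolding x C'[symmetric] by (simp add: A B poly_A_def poly_B_def algebra_simps)
qed

text \<open>With \<open>C_le\<close>, the assumption gives x \<le> H. Then every ingredient of
  \<open>poly_N_via_C\<close> at \<open>x\<close> is at most its counterpart in
  \<open>n_via_C\<close>; as both products equal n, no inequality can be strict, so
  \<open>E = 2\<close> and \<open>C = poly_C H\<close>.\<close>

lemma extremal_if_C_ge:
  assumes "poly_C x \<le> C"
  shows "E = 2 \<and> F = 1 \<and> G = 1"
proof -
  have "poly_C x \<le> poly_C H"
    using assms C_le(1) by linarith
  then have "x \<le> H"
    using poly_C_strict_mono[of "real H" x] by force
  have C: "0 < real C"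
    using B_less_C by simp
  have le1: "x * poly_C x \<le> real H * C"
    using \<open>x \<le> H\<close> assms x_nonneg poly_pos(3)[OF x_nonneg] by (intro mult_mono) auto
  have le2: "2 * (real H * C) \<le> E * (real H * C)"
    using E_ge_2 by (intro mult_right_mono) auto
  have "0 < real H * C"
    using C H_pos by simp
  have "real n = (E * (real H * C) + 1) * (real H * C + 1)"
    by (simp add: n_via_C algebra_simps)
  then have n_eq: "(2 * (x * poly_C x) + 1) * (x * poly_C x + 1)
      = (E * (real H * C) + 1) * (real H * C + 1)"
    using poly_N_x poly_N_via_C[of x] by (simp add: mult.assoc)
  have "E = 2"
  proof (rule ccontr)
    assume "E \<noteq> 2"
    then have "2 < E"
      using E_ge_2 by simp
    then have "2 * (real H * C) < E * (real H * C)"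
      using \<open>0 < real H * C\<close> by (intro mult_strict_right_mono) auto
    then have "(2 * (x * poly_C x) + 1) * (x * poly_C x + 1) < (E * (real H * C) + 1) * (real H * C + 1)"
      using le1 x_nonneg poly_pos(3)[OF x_nonneg] by (intro mult_less_le_imp_less) (auto intro: add_nonneg_pos)
    then show False
      using n_eq by simp
  qed
  have eq: "x * poly_C x = real H * C"
  proof (rule ccontr)
    assume "x * poly_C x \<noteq> real H * C"
    then have less: "x * poly_C x < real H * C"
      using le1 by simp
    then have "(2 * (x * poly_C x) + 1) * (x * poly_C x + 1) < (E * (real H * C) + 1) * (real H * C + 1)"
      using le2 x_nonneg poly_pos(3)[OF x_nonneg] by (intro mult_strict_mono) (auto intro: add_nonneg_pos)
    then show False
      using n_eq by simp
  qed
  have "x = H"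
  proof (rule ccontr)
    assume "x \<noteq> H"
    then have "x * C < real H * C"
      using \<open>x \<le> H\<close> C by simp
    moreover have "x * poly_C x \<le> x * C"
      using assms x_nonneg by (intro mult_left_mono)
    ultimately show False
      using eq by linarith
  qed
  then have "real C = poly_C H"
    using eq H_pos by simp
  with \<open>E = 2\<close> show ?thesis
    using C_le(2) by simp
qed

text \<open>The same comparison between \<open>poly_N_via_ABC\<close> and \<open>n_via_ABC\<close>;
  here the equality case of \<open>ABC_le\<close> also supplies \<open>E = 2\<close>.\<close>

lemma extremal_if_ABC_ge:
  assumes "poly_A x * poly_B x * poly_C x \<le> real (A * B * C)"
  shows "E = 2 \<and> F = 1 \<and> G = 1"
proof -
  define M where "M = real (A * B * C)"
  define P where "P = poly_A x * poly_B x * poly_C x"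
  have "P \<le> poly_A H * poly_B H * poly_C H"
    using assms ABC_le(1) unfolding P_def by linarith
  then have "x \<le> H"
    using poly_ABC_strict_mono[of "real H" x] unfolding P_def by force
  have "0 < P" "P \<le> M" "0 < M"
    using assms poly_pos[OF x_nonneg] A_pos A_less_B B_less_C unfolding P_def M_def by auto
  have eq: "x * P * (x\<^sup>2 + 1) = H * M * (real H ^ 2 + F)"
  proof -
    have "real n = H * M * (real H ^ 2 + F) + 1"
      unfolding n_via_ABC M_def by simp
    then show ?thesis
      using poly_N_x unfolding poly_N_via_ABC P_def by simp
  qed
  have xP: "x * P \<le> H * M"
    using \<open>x \<le> H\<close> \<open>P \<le> M\<close> \<open>0 < P\<close> x_nonneg by (intro mult_mono) auto
  have sq: "x\<^sup>2 + 1 \<le> real H ^ 2 + F"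
    using \<open>x \<le> H\<close> x_nonneg F_pos by (intro add_mono power_mono) auto
  have "H * M \<le> x * P"
  proof (rule ccontr)
    assume "\<not> ?thesis"
    then have "x * P < H * M"
      by simp
    then have "x * P * (x\<^sup>2 + 1) < H * M * (real H ^ 2 + F)"
      using sq by (rule mult_less_le_imp_less) (use x_nonneg \<open>0 < P\<close> in \<open>auto intro: add_nonneg_pos\<close>)
    then show False
      using eq by simp
  qed
  then have "H * M = x * P"
    using xP by simp
  have "x = H"
  proof (rule ccontr)
    assume "x \<noteq> H"
    then have "x * M < H * M"
      using \<open>x \<le> H\<close> \<open>0 < M\<close> by simp
    moreover have "x * P \<le> x * M"
      using \<open>P \<le> M\<close> x_nonneg by (intro mult_left_mono)
    ultimately show False
      using \<open>H * M = x * P\<close> by linarith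
  qed
  then have "M = P"
    using \<open>H * M = x * P\<close> H_pos by simp
  then show ?thesis
    using ABC_le(2) \<open>x = H\<close> unfolding M_def P_def by simp
qed

text \<open>A value that reaches its bound forces the extremal case, where it equals the bound by
  \<open>extremal_values\<close>; so the bound is never exceeded.\<close>

lemma bounds:
  "real C \<le> poly_C x"
  "real (A * B * C) \<le> poly_A x * poly_B x * poly_C x"
  "real C = poly_C x \<longleftrightarrow> E = 2 \<and> F = 1 \<and> G = 1"
  "real (A * B * C) = poly_A x * poly_B x * poly_C x \<longleftrightarrow> E = 2 \<and> F = 1 \<and> G = 1"
  using extremal_if_C_ge extremal_if_ABC_ge extremal_values(5,6)
  by (metis linorder_linear)+

section \<open>Residues of H modulo 3 in the extremal case\<close>

lemma extremal_residue:
  assumes "E = 2" "F = 1" "G = 1" "gcd A (gcd B C) = 1"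
  shows "H mod 3 \<noteq> 2"
proof
  assume "H mod 3 = 2"
  then obtain k where k: "H = 3 * k + 2"
    by (metis mult_div_mod_eq)
  have A: "A = 3 * (k + 1)"
    using extremal_values(1)[OF assms(1-3)] k by simp
  have B: "B = 3 * (3 * k\<^sup>2 + 5 * k + 3)"
    using extremal_values(2)[OF assms(1-3)] k by (simp add: power2_eq_square algebra_simps)
  have "3 dvd 2 * C"
    using EC assms(1) A B by (metis dvd_add dvd_mult dvd_triv_left)
  moreover have "coprime (3::nat) 2"
    by simp
  ultimately have "3 dvd C"
    by (simp add: coprime_dvd_mult_right_iff)
  then have "3 dvd gcd A (gcd B C)"
    using A B by simp
  then show False
    using assms(4) by simp
qed

lemma extremal_residue_prime:
  assumes "E = 2" "F = 1" "G = 1" "even H" "prime (H * A + 1)"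
  shows "H mod 3 \<noteq> 1"
proof
  assume "H mod 3 = 1"
  then obtain k where k: "H = 3 * k + 1"
    by (metis mult_div_mod_eq)
  \<comment> \<open>Here p = H^2 + H + 1 is a multiple of 3, so primality would leave only p = 3 and
    \<open>H = 1\<close>, which is odd.\<close>
  have "H * A + 1 = 3 * (3 * k\<^sup>2 + 3 * k + 1)"
    using extremal_values(1)[OF assms(1-3)] k by (simp add: power2_eq_square algebra_simps)
  then have "3 dvd H * A + 1"
    by (metis dvd_triv_left)
  then have "H * A + 1 = 3"
    using assms(5) by (metis one_eq_numeral_iff prime_nat_iff semiring_norm(84))
  then have "H * (H + 1) = 2"
    using extremal_values(1)[OF assms(1-3)] by simp
  moreover have "2 \<le> H"
    using assms(4) H_pos by (auto elim!: evenE)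
  then have "2 * 3 \<le> H * (H + 1)"
    by (intro mult_le_mono) auto
  ultimately show False
    by simp
qed

end

section \<open>From the definition of \<open>K3N\<close> to the integer equations\<close>

lemma K3N_params:
  assumes "K3N n p q r"
  defines "A \<equiv> A_cof p q r" and "B \<equiv> B_cof p q r" and "C \<equiv> C_cof p q r" and "H \<equiv> H_gcd p q r"
  obtains E F G where
    "korselt3 A B C E F G H" "n = korselt3.n A B C H"
    "E_quot p q r = E" "F_val p q r = F" "G_val p q r = G"
    "even H" "gcd A (gcd B C) = 1" "p = H * A + 1"
proof -
  have n: "n = p * q * r" and less: "1 < p" "p < q" "q < r" and odd: "odd p" "odd q" "odd r"
    and dvd: "p - 1 dvd n - 1" "q - 1 dvd n - 1" "r - 1 dvd n - 1" and Eq: "E_quot p q r \<ge> 2"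
    using assms(1) unfolding K3N_def by auto
  have H_dvd: "H dvd p - 1" "H dvd q - 1" "H dvd r - 1"
    unfolding H_def H_gcd_def by (meson dvd_refl gcd_dvd1 gcd_dvd2 dvd_trans)+
  have HA: "p - 1 = H * A" and HB: "q - 1 = H * B" and HC: "r - 1 = H * C"
    using H_dvd unfolding A_def B_def C_def A_cof_def B_cof_def C_cof_def H_def by simp_all
  have p: "p = H * A + 1" and q: "q = H * B + 1" and r: "r = H * C + 1"
    using HA HB HC less by linarith+
  have "0 < H * A" "H * A < H * B" "H * B < H * C"
    using less p q r by linarith+
  then have pos: "0 < H" "0 < A" "A < B" "B < C"
    by auto
  have "even (p - 1)" "even (q - 1)" "even (r - 1)"
    using odd by auto
  then have "even H"
    unfolding H_def H_gcd_def by simp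
  have "H * gcd A (gcd B C) = gcd (p - 1) (gcd (q - 1) (r - 1))"
    unfolding HA HB HC by (simp add: gcd_mult_distrib_nat)
  also have "\<dots> = H"
    unfolding H_def H_gcd_def ..
  finally have gcd: "gcd A (gcd B C) = 1"
    using pos by simp
  have n': "n - 1 = H * (H\<^sup>2 * (A * B * C) + H * (A * B + A * C + B * C) + A + B + C)"
    unfolding n p q r by (simp add: algebra_simps power2_eq_square)
  have "A dvd H\<^sup>2 * (A * B * C) + H * (A * B + A * C + B * C) + A + B + C"
    "B dvd H\<^sup>2 * (A * B * C) + H * (A * B + A * C + B * C) + A + B + C"
    "C dvd H\<^sup>2 * (A * B * C) + H * (A * B + A * C + B * C) + A + B + C"
    using dvd pos unfolding n' HA HB HC by simp_all
  moreover have "H\<^sup>2 * (A * B * C) + H * (A * B + A * C + B * C) + A + B + C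
        = A * (H\<^sup>2 * (B * C) + H * (B + C) + 1) + (H * B * C + B + C)"
    "H\<^sup>2 * (A * B * C) + H * (A * B + A * C + B * C) + A + B + C
        = B * (H\<^sup>2 * (A * C) + H * (A + C) + 1) + (H * A * C + A + C)"
    "H\<^sup>2 * (A * B * C) + H * (A * B + A * C + B * C) + A + B + C
        = C * (H\<^sup>2 * (A * B) + H * (A + B) + 1) + (H * A * B + A + B)"
    by (simp_all add: algebra_simps)
  ultimately have dvd_A: "A dvd H * B * C + B + C" and dvd_B: "B dvd H * A * C + A + C"
    and dvd_C: "C dvd H * A * B + A + B"
    by (metis dvd_add_right_iff dvd_triv_left)+
  \<comment> \<open>A common divisor of two cofactors divides the third, by \<open>dvd_A\<close> or
    \<open>dvd_B\<close>, and the three together have gcd 1.\<close>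
  have "coprime A B" "coprime A C" "coprime B C"
  proof -
    have *: "d = 1" if "d dvd A" "d dvd B" "d dvd C" for d
      using gcd that by (metis gcd_greatest nat_dvd_1_iff_1)
    show "coprime A B"
    proof (rule coprimeI)
      fix d assume d: "d dvd A" "d dvd B"
      then have "d dvd B * (H * C + 1) + C"
        using dvd_A by (auto simp: algebra_simps intro: dvd_trans)
      then have "d dvd C"
        using d(2) by (metis dvd_add_right_iff dvd_mult2)
      then show "d dvd 1"
        using * d by simp
    qed
    show "coprime A C"
    proof (rule coprimeI)
      fix d assume d: "d dvd A" "d dvd C"
      then have "d dvd C * (H * B + 1) + B"
        using dvd_A by (auto simp: algebra_simps intro: dvd_trans)
      then have "d dvd B"
        using d(2) by (metis dvd_add_right_iff dvd_mult2)
      then show "d dvd 1"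
        using * d by simp
    qed
    show "coprime B C"
    proof (rule coprimeI)
      fix d assume d: "d dvd B" "d dvd C"
      then have "d dvd C * (H * A + 1) + A"
        using dvd_B by (auto simp: algebra_simps intro: dvd_trans)
      then have "d dvd A"
        using d(2) by (metis dvd_add_right_iff dvd_mult2)
      then show "d dvd 1"
        using * d by simp
    qed
  qed
  \<comment> \<open>\<open>S\<close> is the numerator of F over the denominator
    \<open>A * B * C\<close>; pairwise coprimality makes the quotient an integer.\<close>
  define S where "S = H * (A * B + A * C + B * C) + A + B + C"
  have "S = A * (H * B + H * C + 1) + (H * B * C + B + C)"
    "S = B * (H * A + H * C + 1) + (H * A * C + A + C)"
    "S = C * (H * A + H * B + 1) + (H * A * B + A + B)"
    unfolding S_def by (simp_all add: algebra_simps)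
  then have "A dvd S" "B dvd S" "C dvd S"
    using dvd_A dvd_B dvd_C by (metis dvd_add_right_iff dvd_triv_left)+
  then have "A * B * C dvd S"
    using \<open>coprime A B\<close> \<open>coprime A C\<close> \<open>coprime B C\<close> by (intro divides_mult) auto
  then obtain F where F: "S = A * B * C * F" ..
  obtain E where E: "H * A * B + A + B = C * E"
    using dvd_C ..
  \<comment> \<open>Cancelling \<open>C\<close> will show that \<open>B * (A * F)\<close> exceeds
    \<open>B * H\<close>, which is why \<open>G\<close> is positive.\<close>
  have "B * C * (A * F) = B * C * H + C * (H * A + E + 1)"
  proof -
    have "B * C * (A * F) = S"
      unfolding F by simp
    also have "\<dots> = B * C * H + C * (H * A + 1) + (H * A * B + A + B)"
      unfolding S_def by (simp add: algebra_simps)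
    finally show ?thesis
      unfolding E by (simp add: algebra_simps)
  qed
  then have "C * (B * (A * F)) = C * (B * H + (H * A + E + 1))"
    by (simp add: algebra_simps)
  then have BAF: "B * (A * F) = B * H + (H * A + E + 1)"
    using pos by (simp only: mult_left_cancel)
  then have "B * H < B * (A * F)"
    by simp
  then have "H < A * F"
    by simp
  then obtain G where AF: "A * F = G + H" and "0 < G"
    using less_imp_add_positive by (metis add.commute)
  have BG: "B * G = H * A + E + 1"
    using BAF unfolding AF by (simp add: algebra_simps)
  have "0 < F"
    using \<open>H < A * F\<close> by (cases F) auto
  have pq: "p * q - 1 = H * (H * A * B + A + B)"
    unfolding p q by (simp add: algebra_simps)
  have E_quot: "E_quot p q r = E"
    unfolding E_quot_def pq HC E using pos by simp
  have reals: "real A > 0" "real B > 0" "real C > 0"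
    using pos by auto
  have F_val: "F_val p q r = F"
  proof -
    have "F_val p q r = real S / (real A * B * C)"
      unfolding F_val_def Let_def A_def[symmetric] B_def[symmetric] C_def[symmetric]
        H_def[symmetric] S_def using reals by (simp add: field_simps)
    then show ?thesis
      unfolding F using reals by simp
  qed
  have "real A * F = real G + H"
    using AF by (metis of_nat_add of_nat_mult)
  then have G_val: "G_val p q r = G"
    unfolding G_val_def F_val A_def[symmetric] H_def[symmetric] by simp
  have "korselt3 A B C E F G H"
    using pos Eq \<open>0 < F\<close> \<open>0 < G\<close> AF BG E E_quot by unfold_locales (auto simp: mult.commute)
  moreover from this have "n = korselt3.n A B C H"
    unfolding n by (simp add: korselt3.n_def p q r)
  ultimately show ?thesis
    using E_quot F_val G_val \<open>even H\<close> gcd p by (rule that)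
qed

section \<open>Asymptotics\<close>

lemma filterlim_N_inv: "filterlim (\<lambda>n. N_inv (real n)) at_top sequentially"
  unfolding filterlim_at_top
proof
  fix z :: real
  have "\<forall>\<^sub>F n in sequentially. poly_N (max z 0) \<le> real n"
    using filterlim_real_sequentially unfolding filterlim_at_top by blast
  with eventually_ge_at_top[of 1] show "\<forall>\<^sub>F n in sequentially. z \<le> N_inv (real n)"
  proof eventually_elim
    case (elim n)
    then have n: "1 \<le> real n"
      by simp
    show ?case
      using poly_N_strict_mono[of "N_inv (real n)" "max z 0"] N_inv_nonneg[OF n] poly_N_N_inv[OF n] elim
      by force
  qed
qed

text \<open>The constant left over in the two limits below: \<open>poly_N\<close> and the numerators
  all have leading coefficient 1/2, and the exponents satisfy 3/5 + 2/5 = 3/10 + 7/10 = 1.\<close>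

lemma inverse_powr_half:
  fixes a b :: real
  assumes "a + b = 1"
  shows "inverse (2 powr - a) * inverse ((1 / 2) powr b) / 2 = 1"
  using assms by (simp add: powr_minus powr_divide flip: powr_add)

lemma poly_C_asymp:
  "((\<lambda>x. poly_C x / (2 powr (-3/5) * poly_N x powr (2/5)) - 1) \<longlongrightarrow> 0) at_top"
  unfolding poly_C_def poly_N_def
  by (real_asymp simp: inverse_powr_half)

lemma poly_ABC_asymp:
  "((\<lambda>x. poly_A x * poly_B x * poly_C x / (2 powr (-3/10) * poly_N x powr (7/10)) - 1) \<longlongrightarrow> 0) at_top"
  unfolding poly_A_def poly_B_def poly_C_def poly_N_def
  by (real_asymp simp: inverse_powr_half)

lemma asymptotic_bound:
  fixes f :: "real \<Rightarrow> real"
  assumes lim: "((\<lambda>x. f x / (c * poly_N x powr a) - 1) \<longlongrightarrow> 0) at_top" and "0 < c"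
    and bound: "\<And>n p q r. K3N n p q r \<Longrightarrow> b p q r \<le> f (N_inv (real n))"
  shows "\<exists>\<epsilon> :: nat \<Rightarrow> real. \<epsilon> \<in> o(\<lambda>_. 1) \<and>
      (\<forall>\<^sub>F n in sequentially. \<forall>p q r. K3N n p q r \<longrightarrow> b p q r \<le> c * real n powr a * (1 + \<epsilon> n))"
proof (intro exI conjI)
  \<comment> \<open>Chosen so that the claimed right-hand side is exactly
    \<open>f (N_inv (real n))\<close>; it depends on \<open>n\<close> alone.\<close>
  let ?\<epsilon> = "\<lambda>n. f (N_inv (real n)) / (c * poly_N (N_inv (real n)) powr a) - 1"
  have "?\<epsilon> \<longlonglongrightarrow> 0"
    using filterlim_compose[OF lim filterlim_N_inv] .
  then show "?\<epsilon> \<in> o(\<lambda>_. 1)"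
    by (intro smalloI_tendsto) auto
  show "\<forall>\<^sub>F n in sequentially. \<forall>p q r. K3N n p q r \<longrightarrow> b p q r \<le> c * real n powr a * (1 + ?\<epsilon> n)"
    using eventually_ge_at_top[of 1]
  proof eventually_elim
    case (elim n)
    then have "c * real n powr a * (1 + ?\<epsilon> n) = f (N_inv (real n))"
      using poly_N_N_inv[of "real n"] \<open>0 < c\<close> by simp
    then show ?case
      using bound by simp
  qed
qed

section \<open>Transfer to \<open>K3N\<close> and conclusion\<close>

lemma K3N_bounds:
  assumes "K3N n p q r"
  defines "x \<equiv> N_inv (real n)" and "H \<equiv> H_gcd p q r"
    and "A \<equiv> A_cof p q r" and "B \<equiv> B_cof p q r" and "C \<equiv> C_cof p q r"
    and "extremal \<equiv> E_quot p q r = 2 \<and> F_val p q r = 1 \<and> G_val p q r = 1"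
  shows "real C \<le> poly_C x"
    and "real (A * B * C) \<le> poly_A x * poly_B x * poly_C x"
    and "real C = poly_C x \<longleftrightarrow> extremal"
    and "real (A * B * C) = poly_A x * poly_B x * poly_C x \<longleftrightarrow> extremal"
    and "extremal \<Longrightarrow> [H \<noteq> 2] (mod 6)"
    and "extremal \<Longrightarrow> C3N n p q r \<Longrightarrow> [H = 0] (mod 6)"
proof -
  obtain E F G where k: "korselt3 A B C E F G H" and n: "n = korselt3.n A B C H"
    and vals: "E_quot p q r = E" "F_val p q r = F" "G_val p q r = G"
    and H: "even H" and gcd: "gcd A (gcd B C) = 1" and p: "p = H * A + 1"
    using K3N_params[OF assms(1)] unfolding A_def B_def C_def H_def by metis
  have extremal: "extremal \<longleftrightarrow> E = 2 \<and> F = 1 \<and> G = 1"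
    unfolding extremal_def vals by simp
  interpret korselt3 A B C E F G H
    by (rule k)
  show "real C \<le> poly_C x"
    and "real (A * B * C) \<le> poly_A x * poly_B x * poly_C x"
    and "real C = poly_C x \<longleftrightarrow> extremal"
    and "real (A * B * C) = poly_A x * poly_B x * poly_C x \<longleftrightarrow> extremal"
    unfolding x_def n extremal using bounds by auto
  assume extremal
  then have not_2: "H mod 3 \<noteq> 2"
    using extremal_residue gcd extremal by simp
  then show "[H \<noteq> 2] (mod 6)"
    unfolding unique_euclidean_semiring_class.cong_def by presburger
  assume "C3N n p q r"
  then have "prime (H * A + 1)"
    using p unfolding C3N_def by simp
  then have "H mod 3 \<noteq> 1"
    using extremal_residue_prime \<open>extremal\<close> extremal H by simp
  with not_2 H show "[H = 0] (mod 6)"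
    unfolding unique_euclidean_semiring_class.cong_def by presburger
qed

theorem theorem4p10:
  shows
   "(\<forall>n p q r. K3N n p q r \<longrightarrow>
      (let x = N_inv (real n);
           H = H_gcd p q r; A = A_cof p q r; B = B_cof p q r; C = C_cof p q r;
           eq_a = (real C = poly_C x);
           eq_b = (real (A * B * C) = poly_A x * poly_B x * poly_C x);
           extremal = (E_quot p q r = 2 \<and> F_val p q r = 1 \<and> G_val p q r = 1)
       in real C \<le> poly_C x \<and>
          real (A * B * C) \<le> poly_A x * poly_B x * poly_C x \<and>
          (eq_a \<longleftrightarrow> extremal) \<and>
          (eq_b \<longleftrightarrow> extremal) \<and>
          (eq_a \<or> eq_b \<longrightarrow> [H \<noteq> 2] (mod 6)) \<and>
          ((eq_a \<or> eq_b) \<and> C3N n p q r \<longrightarrow> [H = 0] (mod 6)))) \<and>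
    (\<exists>\<epsilon> :: nat \<Rightarrow> real. \<epsilon> \<in> o(\<lambda>_. 1) \<and>
      (\<forall>\<^sub>F n in sequentially. \<forall>p q r. K3N n p q r \<longrightarrow>
         real (C_cof p q r) \<le> 2 powr (- 3 / 5) * real n powr (2 / 5) * (1 + \<epsilon> n))) \<and>
    (\<exists>\<epsilon> :: nat \<Rightarrow> real. \<epsilon> \<in> o(\<lambda>_. 1) \<and>
      (\<forall>\<^sub>F n in sequentially. \<forall>p q r. K3N n p q r \<longrightarrow>
         real (A_cof p q r * B_cof p q r * C_cof p q r)
           \<le> 2 powr (- 3 / 10) * real n powr (7 / 10) * (1 + \<epsilon> n)))"
proof (intro conjI allI impI)
  fix n p q r assume "K3N n p q r"
  note * = K3N_bounds[OF this]
  show "let x = N_inv (real n);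
           H = H_gcd p q r; A = A_cof p q r; B = B_cof p q r; C = C_cof p q r;
           eq_a = (real C = poly_C x);
           eq_b = (real (A * B * C) = poly_A x * poly_B x * poly_C x);
           extremal = (E_quot p q r = 2 \<and> F_val p q r = 1 \<and> G_val p q r = 1)
       in real C \<le> poly_C x \<and>
          real (A * B * C) \<le> poly_A x * poly_B x * poly_C x \<and>
          (eq_a \<longleftrightarrow> extremal) \<and>
          (eq_b \<longleftrightarrow> extremal) \<and>
          (eq_a \<or> eq_b \<longrightarrow> [H \<noteq> 2] (mod 6)) \<and>
          ((eq_a \<or> eq_b) \<and> C3N n p q r \<longrightarrow> [H = 0] (mod 6))"
    unfolding Let_def using * by blast
qed (rule asymptotic_bound[OF poly_C_asymp _ K3N_bounds(1)]
      asymptotic_bound[OF poly_ABC_asymp _ K3N_bounds(2)]; simp)+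

end
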